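(* Let $S\subset\mathbb{R}^n$ be closed and convex, let $\phi:\mathbb{R}^n\times\mathbb{R}^n\to\mathbb{R}$ satisfy $\phi(x,x)=0$ for all $x\in S$, assume $\phi(x,\cdot)$ is continuously differentiable on $\mathbb{R}^n$ for every $x\in S$, and let $\bar S=\{x\in S\mid \phi(x,y)\ge 0\ \forall y\in S\}$ be nonempty and closed. Suppose $x\mapsto\nabla_y\phi(x,x)$ is continuous over $S$, and $\{x^k\}\subset S$ is a bounded sequence every accumulation point of which is strongly non-degenerate. Then $\bar S$ is augmented weakly sharp with respect to $\{x^k\}$.
   Context: For $x\in S$, $\nabla_y\phi(x,x)$ is the gradient of the function $\phi(x,\cdot)$ at the point $x$, and $\partial_y\phi(x,x)=\{\nabla_y\phi(x,x)\}$. A point $\bar x$ is strongly non-degenerate if $\bar x\in\bar S$ and $-\nabla_y\phi(\bar x,\bar x)\in\operatorname{int}N_S(\bar x)$, where $N_S(\bar x)=\{d\mid\langle d,y-\bar x\rangle\le0\ \forall y\in S\}$ is the normal cone of the convex set $S$. For $C\subset\mathbb{R}^n$ and $x\in C$: the tangent cone $T_C(x)$ is the set of $d$ for which there are $x^j\in C$, $x^j\to x$, $\tau^j\downarrow0$ with $(x^j-x)/\tau^j\to d$; the regular normal cone is $\hat N_C(x)=\{d\mid\langle d,y-x\rangle\le o(\|y-x\|),\ y\in C\}$. For a set $D$, $D^\circ=\{y\mid\langle y,d\rangle\le0\ \forall d\in D\}$. $B$ is the closed unit ball. $P_C(x)$ is the projection, i.e. a point of $\arg\min_{y\in C}\|y-x\|$;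 if the nearest point is not unique, $P_C(x)$ denotes one nearest point, chosen once and for all. Augmented weak sharpness: $\bar S$ (closed) is augmented weakly sharp with respect to $\{x^k\}\subset S$ if, whenever $K=\{k\mid x^k\notin\bar S\}$ is infinite, there exists a set-valued mapping $H:\bar S\to2^{\mathbb{R}^n}$ such that (a) there is a constant $\alpha>0$ with $\alpha B\subset H(z)+[T_S(z)\cap\hat N_{\bar S}(z)]^\circ$ for all $z\in\bar S$; (b) for all choices $v^k\in H(P_{\bar S}(x^k))$ ($k\in K$), with $u^k=\nabla_y\phi(x^k,x^k)$, $$\limsup_{k\in K,\,k\to\infty}\frac{1}{\|x^k-P_{\bar S}(x^k)\|}\langle u^k-v^k,\,x^k-P_{\bar S}(x^k)\rangle\ge0.$$ (If $K$ is finite the condition holds vacuously.) *)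

theory Defs
  imports "HOL-Analysis.Analysis"
begin

definition gradient :: "('a::real_inner \<Rightarrow> real) \<Rightarrow> 'a \<Rightarrow> 'a" where
  "gradient f x = (THE D. GDERIV f x :> D)"

lemma gradient_eqI:
  assumes "GDERIV f x :> D"
  shows "gradient f x = D"
  unfolding gradient_def
proof (rule the_equality)
  fix E assume "GDERIV f x :> E"
  then have "(\<lambda>h. inner h E) = (\<lambda>h. inner h D)"
    using assms has_derivative_unique unfolding gderiv_def by blast
  then show "E = D"
    by (metis inner_commute vector_eq_ldot)
qed (fact assms)

definition continuously_differentiable :: "('a::real_inner \<Rightarrow> real) \<Rightarrow> bool" where
  "continuously_differentiable f \<longleftrightarrow>
     (\<exists>G. (\<forall>y. GDERIV f y :> G y) \<and> continuous_on UNIV G)"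

definition solution_set :: "('a \<Rightarrow> 'a \<Rightarrow> real) \<Rightarrow> 'a set \<Rightarrow> 'a set" where
  "solution_set \<phi> S = {x \<in> S. \<forall>y\<in>S. \<phi> x y \<ge> 0}"

definition normal_cone :: "'a::real_inner set \<Rightarrow> 'a \<Rightarrow> 'a set" where
  "normal_cone S x = {d. \<forall>y\<in>S. inner d (y - x) \<le> 0}"

definition tangent_cone :: "'a::real_normed_vector set \<Rightarrow> 'a \<Rightarrow> 'a set" where
  "tangent_cone C x = {d. \<exists>X \<tau>. (\<forall>j::nat. X j \<in> C) \<and> X \<longlonglongrightarrow> x \<and>
     (\<forall>j. \<tau> j > (0::real)) \<and> \<tau> \<longlonglongrightarrow> 0 \<and>
     (\<lambda>j. (X j - x) /\<^sub>R \<tau> j) \<longlonglongrightarrow> d}"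

text \<open>The condition on \<open>d\<close> spells out \<open>inner d (y - x) \<le> o(norm (y - x))\<close>, a one-sided bound,
  as \<open>y\<close> tends to \<open>x\<close> in \<open>C\<close>; at an isolated point of \<open>C\<close> it holds for every \<open>d\<close>.\<close>
definition regular_normal_cone :: "'a::real_inner set \<Rightarrow> 'a \<Rightarrow> 'a set" where
  "regular_normal_cone C x =
     {d. \<forall>\<epsilon>>0. \<forall>\<^sub>F y in at x within C. inner d (y - x) \<le> \<epsilon> * norm (y - x)}"

definition polar :: "'a::real_inner set \<Rightarrow> 'a set" where
  "polar D = {y. \<forall>d\<in>D. inner y d \<le> 0}"

text \<open>\<open>P\<close> selects one nearest point of \<open>C\<close> for each \<open>x\<close>; for non-convex \<open>C\<close> there may be
  several selections.\<close>
definition projection_onto :: "('a::real_normed_vector \<Rightarrow> 'a) \<Rightarrow> 'a set \<Rightarrow> bool" where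
  "projection_onto P C \<longleftrightarrow> (\<forall>x. is_arg_min (\<lambda>y. norm (y - x)) (\<lambda>y. y \<in> C) (P x))"

definition strongly_nondegenerate ::
  "('a::real_inner \<Rightarrow> 'a \<Rightarrow> real) \<Rightarrow> 'a set \<Rightarrow> 'a \<Rightarrow> bool" where
  "strongly_nondegenerate \<phi> S z \<longleftrightarrow>
     z \<in> solution_set \<phi> S \<and> - gradient (\<phi> z) z \<in> interior (normal_cone S z)"

text \<open>The sum in the first condition is the Minkowski sum. The filter
  \<open>inf sequentially (principal K)\<close> describes \<open>k \<in> K, k \<rightarrow> \<infinity>\<close>; it is proper since \<open>K\<close> is infinite.\<close>
definition augmented_weakly_sharp ::
  "('a::real_inner \<Rightarrow> 'a \<Rightarrow> real) \<Rightarrow> 'a set \<Rightarrow> ('a \<Rightarrow> 'a) \<Rightarrow> (nat \<Rightarrow> 'a) \<Rightarrow> bool" where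
  "augmented_weakly_sharp \<phi> S P x \<longleftrightarrow>
    (let Sb = solution_set \<phi> S; K = {k. x k \<notin> Sb} in
      infinite K \<longrightarrow>
      (\<exists>H :: 'a \<Rightarrow> 'a set.
        (\<exists>\<alpha>>0. \<forall>z\<in>Sb.
           cball 0 \<alpha> \<subseteq> H z + polar (tangent_cone S z \<inter> regular_normal_cone Sb z)) \<and>
        (\<forall>v. (\<forall>k\<in>K. v k \<in> H (P (x k))) \<longrightarrow>
           Limsup (inf sequentially (principal K))
             (\<lambda>k. ereal (inner (gradient (\<phi> (x k)) (x k) - v k) (x k - P (x k))
                          / norm (x k - P (x k)))) \<ge> 0)))"

end

theory Submission
  imports Defs
begin

text \<open>At a strongly non-degenerate point \<open>z\<close> the gradient map \<open>g\<close> satisfies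
  \<open>inner (g z) (y - z) \<ge> \<delta> * norm (y - z)\<close> on \<open>S\<close>. By continuity of \<open>g\<close>, near \<open>z\<close> also
  \<open>inner (g y) (y - z) \<ge> \<delta>/2 * norm (y - z)\<close>. At a solution \<open>y\<close> first-order optimality
  makes the left-hand side nonpositive, so \<open>z\<close> is isolated in the solution set. Hence along a
  subsequence of \<open>x\<close> outside the solution set that converges to such a \<open>z\<close>, the projections
  eventually equal \<open>z\<close>, and the constant mapping \<open>H = cball 0 (\<delta>/2)\<close> works.\<close>

text \<open>Restricted to the segment from \<open>u\<close> towards \<open>y\<close>, the function
  has derivative \<open>inner D (y - u)\<close> at 0. Were it negative, \<open>f\<close> would drop
  below \<open>f u\<close> at points of the segment close to \<open>u\<close>, which convexity keeps
  in \<open>S\<close>.\<close>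

lemma inner_gradient_nonneg_of_minimum:
  fixes f :: "'a::real_inner \<Rightarrow> real"
  assumes "convex S" "u \<in> S" "y \<in> S"
    and deriv: "GDERIV f u :> D"
    and min: "\<And>w. w \<in> S \<Longrightarrow> f u \<le> f w"
  shows "inner D (y - u) \<ge> 0"
proof (rule ccontr)
  assume neg: "\<not> ?thesis"
  \<comment> \<open>The base point is written as the value of the segment at parameter 0, so that
    the chain rule applies.\<close>
  have "(f has_derivative (\<lambda>h. inner h D)) (at (u + 0 *\<^sub>R (y - u)))"
    using deriv by (simp add: gderiv_def)
  moreover have "((\<lambda>t. u + t *\<^sub>R (y - u)) has_derivative (\<lambda>t. t *\<^sub>R (y - u))) (at (0::real))"
    by (auto intro!: derivative_eq_intros)
  ultimately have
    "((\<lambda>t. f (u + t *\<^sub>R (y - u))) has_derivative (\<lambda>t. inner (t *\<^sub>R (y - u)) D)) (at (0::real))"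
    by (rule has_derivative_compose[rotated])
  then have "((\<lambda>t. f (u + t *\<^sub>R (y - u))) has_real_derivative inner D (y - u)) (at 0)"
    by (simp add: has_field_derivative_def inner_commute[of D] mult_commute_abs)
  from DERIV_neg_dec_right[OF this] neg obtain d where "d > 0"
    and d: "\<And>h. h > 0 \<Longrightarrow> h < d \<Longrightarrow> f (u + h *\<^sub>R (y - u)) < f u"
    by auto
  \<comment> \<open>The bound \<open>d / 2\<close> keeps \<open>h\<close> in the range of strict
    decrease; the bound 1 makes the point a convex combination of \<open>u\<close> and
    \<open>y\<close>.\<close>
  define h where "h = min 1 (d / 2)"
  have h: "0 < h" "h < d" "h \<le> 1"
    using \<open>d > 0\<close> by (auto simp: h_def)
  have "(1 - h) *\<^sub>R u + h *\<^sub>R y \<in> S"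
    using assms(1-3) h by (intro convexD) auto
  then have "u + h *\<^sub>R (y - u) \<in> S"
    by (simp add: algebra_simps)
  with min d[OF h(1,2)] show False
    by force
qed

text \<open>Since \<open>\<phi> u u = 0\<close>, a solution \<open>u\<close> minimises
  \<open>\<phi> u\<close> over \<open>S\<close>, so the preceding optimality condition
  applies.\<close>

lemma solution_set_first_order:
  assumes "convex S" and "\<And>z. z \<in> S \<Longrightarrow> \<phi> z z = 0"
    and "\<And>z. z \<in> S \<Longrightarrow> continuously_differentiable (\<phi> z)"
    and "u \<in> solution_set \<phi> S" "y \<in> S"
  shows "inner (gradient (\<phi> u) u) (y - u) \<ge> 0"
proof -
  have u: "u \<in> S" "\<And>w. w \<in> S \<Longrightarrow> \<phi> u u \<le> \<phi> u w"
    using assms(2,4) by (auto simp: solution_set_def)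
  then obtain D where D: "GDERIV (\<phi> u) u :> D"
    using assms(3) unfolding continuously_differentiable_def by blast
  show ?thesis
    using inner_gradient_nonneg_of_minimum[OF assms(1) u(1) assms(5) D u(2)] gradient_eqI[OF D]
    by simp
qed

text \<open>Here \<delta> is the radius of a ball around the negative gradient inside the normal
  cone. Moving from its centre by \<delta> in the direction of \<open>y - z\<close> turns the normal
  cone inequality into linear growth.\<close>

lemma strongly_nondegenerate_sharp:
  assumes "strongly_nondegenerate \<phi> S z"
  obtains \<delta> where "\<delta> > 0"
    "\<And>y. y \<in> S \<Longrightarrow> \<delta> * norm (y - z) \<le> inner (gradient (\<phi> z) z) (y - z)"
proof -
  let ?g = "gradient (\<phi> z) z"
  obtain \<delta> where "\<delta> > 0" and \<delta>: "cball (- ?g) \<delta> \<subseteq> normal_cone S z"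
    using assms unfolding strongly_nondegenerate_def mem_interior_cball by auto
  have "\<delta> * norm (y - z) \<le> inner ?g (y - z)" if "y \<in> S" for y
  proof -
    \<comment> \<open>For \<open>y = z\<close> the value \<open>sgn 0 = 0\<close> gives the centre,
      so both cases are covered at once.\<close>
    have "- ?g + \<delta> *\<^sub>R sgn (y - z) \<in> cball (- ?g) \<delta>"
      using \<open>\<delta> > 0\<close> by (simp add: dist_norm norm_sgn)
    with \<delta> that have "inner (- ?g + \<delta> *\<^sub>R sgn (y - z)) (y - z) \<le> 0"
      unfolding normal_cone_def by blast
    moreover have "inner (sgn (y - z)) (y - z) = norm (y - z)"
      by (cases "y = z") (simp_all add: sgn_div_norm dot_square_norm power2_eq_square)
    ultimately show ?thesis
      by (simp add: inner_diff_left)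
  qed
  with \<open>\<delta> > 0\<close> that show thesis by blast
qed

text \<open>By Cauchy-Schwarz, replacing \<open>g z\<close> by a vector within \<delta>/2 of it
  costs at most half of the growth.\<close>

lemma sharp_neighbourhood:
  fixes g :: "'a::real_inner \<Rightarrow> 'a"
  assumes "continuous_on S g" "z \<in> S" "\<delta> > 0"
    and sharp: "\<And>y. y \<in> S \<Longrightarrow> \<delta> * norm (y - z) \<le> inner (g z) (y - z)"
  obtains e where "e > 0"
    "\<And>y. y \<in> S \<Longrightarrow> dist y z < e \<Longrightarrow> \<delta> / 2 * norm (y - z) \<le> inner (g y) (y - z)"
proof -
  have "\<exists>e>0. \<forall>y\<in>S. dist y z < e \<longrightarrow> dist (g y) (g z) < \<delta> / 2"
    using assms(1-3) unfolding continuous_on_iff by (meson half_gt_zero)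
  then obtain e where "e > 0"
    and e: "\<And>y. y \<in> S \<Longrightarrow> dist y z < e \<Longrightarrow> dist (g y) (g z) < \<delta> / 2"
    by blast
  have "\<delta> / 2 * norm (y - z) \<le> inner (g y) (y - z)" if "y \<in> S" "dist y z < e" for y
  proof -
    have "norm (g y - g z) \<le> \<delta> / 2"
      using e[OF that] by (simp add: dist_norm)
    then have "norm (g y - g z) * norm (y - z) \<le> \<delta> / 2 * norm (y - z)"
      by (rule mult_right_mono) simp
    then have "- (\<delta> / 2 * norm (y - z)) \<le> inner (g y - g z) (y - z)"
      using Cauchy_Schwarz_ineq2[of "g y - g z" "y - z"] by linarith
    with sharp[OF that(1)] show ?thesis
      by (simp add: inner_diff_left)
  qed
  with \<open>e > 0\<close> that show thesis by blast
qed

text \<open>Bolzano-Weierstrass along the increasing enumeration of \<open>K\<close>. The composed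
  index map is a subsequence of \<open>x\<close> itself, so its limit is an accumulation point of
  the whole sequence.\<close>

lemma bounded_sequence_infinite_subsequence:
  fixes x :: "nat \<Rightarrow> 'a::heine_borel"
  assumes "bounded (range x)" "infinite K"
  obtains r z where "strict_mono r" "\<And>j. r j \<in> K" "(x \<circ> r) \<longlonglongrightarrow> z"
proof -
  have "bounded (range (x \<circ> enumerate K))"
    using assms(1) by (rule bounded_subset) auto
  then obtain z s where s: "strict_mono s" "((x \<circ> enumerate K) \<circ> s) \<longlonglongrightarrow> z"
    using bounded_imp_convergent_subsequence by blast
  show thesis
  proof (rule that)
    show "strict_mono (enumerate K \<circ> s)"
      using assms(2) s(1) by (intro strict_mono_o strict_mono_enumerate)
    show "(enumerate K \<circ> s) j \<in> K" for j
      using assms(2) by (simp add: enumerate_in_set)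
    show "(x \<circ> (enumerate K \<circ> s)) \<longlonglongrightarrow> z"
      using s(2) by (simp add: o_assoc)
  qed
qed

text \<open>A smaller upper limit would force \<open>f k < c\<close> for all late \<open>k\<close>
  in \<open>K\<close>, hence along \<open>r\<close>. A single subsequence in \<open>K\<close>
  therefore suffices for condition (b).\<close>

lemma Limsup_ge_of_subsequence:
  fixes f :: "nat \<Rightarrow> ereal"
  assumes "strict_mono r" "\<And>j. r j \<in> K"
    and ev: "\<forall>\<^sub>F j in sequentially. c \<le> f (r j)"
  shows "c \<le> Limsup (inf sequentially (principal K)) f"
proof (rule ccontr)
  assume "\<not> ?thesis"
  then have "\<forall>\<^sub>F k in inf sequentially (principal K). f k < c"
    by (intro Limsup_lessD) simp
  then have "\<forall>\<^sub>F k in sequentially. k \<in> K \<longrightarrow> f k < c"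
    by (simp add: eventually_inf_principal)
  then have "\<forall>\<^sub>F j in sequentially. r j \<in> K \<longrightarrow> f (r j) < c"
    using assms(1) by (rule eventually_subseq[rotated])
  with ev have "\<forall>\<^sub>F j in sequentially. False"
    by eventually_elim (use assms(2) in \<open>auto dest: leD\<close>)
  then show False
    by simp
qed

theorem proposition3p6:
  fixes S :: "'a::euclidean_space set"
    and \<phi> :: "'a \<Rightarrow> 'a \<Rightarrow> real"
    and P :: "'a \<Rightarrow> 'a"
    and x :: "nat \<Rightarrow> 'a"
  assumes "closed S" and "convex S"
    and "\<And>z. z \<in> S \<Longrightarrow> \<phi> z z = 0"
    and "\<And>z. z \<in> S \<Longrightarrow> continuously_differentiable (\<phi> z)"
    and "solution_set \<phi> S \<noteq> {}" and "closed (solution_set \<phi> S)"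
    and "projection_onto P (solution_set \<phi> S)"
    and "continuous_on S (\<lambda>z. gradient (\<phi> z) z)"
    and "\<And>k. x k \<in> S" and "bounded (range x)"
    and "\<And>r z. strict_mono r \<Longrightarrow> (x \<circ> r) \<longlonglongrightarrow> z \<Longrightarrow> strongly_nondegenerate \<phi> S z"
  shows "augmented_weakly_sharp \<phi> S P x"
proof -
  define Sb where "Sb = solution_set \<phi> S"
  define K where "K = {k. x k \<notin> Sb}"
  define g where "g = (\<lambda>z. gradient (\<phi> z) z)"
  show ?thesis
    unfolding augmented_weakly_sharp_def Let_def Sb_def[symmetric] K_def[symmetric]
  proof (intro impI)
    assume "infinite K"
    with \<open>bounded (range x)\<close> obtain r z
      where r: "strict_mono r" "\<And>j. r j \<in> K" and lim: "(x \<circ> r) \<longlonglongrightarrow> z"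
      by (rule bounded_sequence_infinite_subsequence) blast
    have nd: "strongly_nondegenerate \<phi> S z"
      by (rule assms(11)[OF r(1) lim])
    then have z: "z \<in> Sb" "z \<in> S"
      by (auto simp: strongly_nondegenerate_def Sb_def solution_set_def)
    obtain \<delta> where "\<delta> > 0"
      and \<delta>: "\<And>y. y \<in> S \<Longrightarrow> \<delta> * norm (y - z) \<le> inner (g z) (y - z)"
      using strongly_nondegenerate_sharp[OF nd] unfolding g_def by blast
    obtain e where "e > 0"
      and e: "\<And>y. y \<in> S \<Longrightarrow> dist y z < e \<Longrightarrow> \<delta> / 2 * norm (y - z) \<le> inner (g y) (y - z)"
      using sharp_neighbourhood[of S g z \<delta>] assms(8) z(2) \<open>\<delta> > 0\<close> \<delta> unfolding g_def by blast
    have isolated: "y = z" if "y \<in> Sb" "dist y z < e" for y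
    proof -
      have "y \<in> S"
        using that(1) by (simp add: Sb_def solution_set_def)
      have "inner (g y) (z - y) \<ge> 0"
        using solution_set_first_order[OF assms(2-4) _ z(2)] that(1)
        unfolding g_def Sb_def by blast
      with e[OF \<open>y \<in> S\<close> that(2)] have "\<delta> / 2 * norm (y - z) \<le> 0"
        by (simp add: inner_diff_right)
      with \<open>\<delta> > 0\<close> show "y = z"
        by (simp add: mult_le_0_iff)
    qed
    \<comment> \<open>The solution \<open>z\<close> competes with \<open>P w\<close> for being
      nearest to \<open>w\<close>.\<close>
    have P: "P w \<in> Sb" "norm (P w - w) \<le> norm (z - w)" for w
      using assms(7) z(1) unfolding projection_onto_def is_arg_min_linorder Sb_def by blast+
    \<comment> \<open>The radius is halved because \<open>P w\<close> can be twice as far from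
      \<open>z\<close> as \<open>w\<close> is.\<close>
    have near: "\<forall>\<^sub>F j in sequentially. dist (x (r j)) z < e / 2"
      using tendstoD[OF lim, of "e / 2"] \<open>e > 0\<close> by simp
    show "\<exists>H. (\<exists>\<alpha>>0. \<forall>z\<in>Sb. cball 0 \<alpha> \<subseteq>
                H z + polar (tangent_cone S z \<inter> regular_normal_cone Sb z)) \<and>
           (\<forall>v. (\<forall>k\<in>K. v k \<in> H (P (x k))) \<longrightarrow>
             0 \<le> Limsup (inf sequentially (principal K))
               (\<lambda>k. ereal (inner (gradient (\<phi> (x k)) (x k) - v k) (x k - P (x k))
                            / norm (x k - P (x k)))))"
    proof (intro exI[of _ "\<lambda>_. cball 0 (\<delta> / 2)"] exI[of _ "\<delta> / 2"] conjI ballI allI impI)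
      show "\<delta> / 2 > 0"
        using \<open>\<delta> > 0\<close> by simp
      show "cball 0 (\<delta> / 2) \<subseteq>
          cball 0 (\<delta> / 2) + polar (tangent_cone S y \<inter> regular_normal_cone Sb y)" for y
        \<comment> \<open>A polar contains 0, so adding it to the ball cannot lose points, whatever
          the cones are.\<close>
        using set_zero_plus2[of "polar (tangent_cone S y \<inter> regular_normal_cone Sb y)"
            "cball 0 (\<delta> / 2)"]
        by (simp add: polar_def add.commute)
    next
      fix v :: "nat \<Rightarrow> 'a"
      assume v: "\<forall>k\<in>K. v k \<in> cball 0 (\<delta> / 2)"
      show "0 \<le> Limsup (inf sequentially (principal K))
               (\<lambda>k. ereal (inner (gradient (\<phi> (x k)) (x k) - v k) (x k - P (x k))
                            / norm (x k - P (x k))))"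
      proof (rule Limsup_ge_of_subsequence[OF r], rule eventually_mono[OF near])
        fix j assume close: "dist (x (r j)) z < e / 2"
        define w where "w = x (r j)"
        have "dist (P w) z \<le> dist (P w) w + dist w z"
          by (rule dist_triangle)
        also have "\<dots> < e"
          using P(2)[of w] close by (simp add: dist_norm norm_minus_commute w_def)
        finally have Pw: "P w = z"
          using isolated P(1) by blast
        have "dist w z < e"
          using close \<open>e > 0\<close> by (simp add: w_def)
        then have "\<delta> / 2 * norm (w - z) \<le> inner (g w) (w - z)"
          using e assms(9) by (simp add: w_def)
        \<comment> \<open>The radius \<delta>/2 of the values of \<open>H\<close> is exactly the
          growth rate left near \<open>z\<close>, so no choice of \<open>v\<close> can outweigh the
          gradient term.\<close>
        moreover have "inner (v (r j)) (w - z) \<le> \<delta> / 2 * norm (w - z)"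
        proof -
          have "norm (v (r j)) \<le> \<delta> / 2"
            using v r(2)[of j] by simp
          then have "norm (v (r j)) * norm (w - z) \<le> \<delta> / 2 * norm (w - z)"
            by (rule mult_right_mono) simp
          with norm_cauchy_schwarz[of "v (r j)" "w - z"] show ?thesis
            by linarith
        qed
        ultimately have "0 \<le> inner (g w - v (r j)) (w - z)"
          by (simp add: inner_diff_left)
        \<comment> \<open>With \<open>P w = z\<close> this is the numerator, and dividing by a norm
          keeps it nonnegative.\<close>
        then show "0 \<le> ereal (inner (gradient (\<phi> (x (r j))) (x (r j)) - v (r j))
              (x (r j) - P (x (r j))) / norm (x (r j) - P (x (r j))))"
          using Pw by (simp add: g_def w_def)
      qed
    qed
  qed
qed

end
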